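(* Let $d\ge2$, let $g\in\mathrm{GL}_d(\tilde{\mathcal K})$ and let $\Lambda=g\mathcal R^d$. Then there exist $u\in\mathrm{SL}_d(\mathcal O)$ and $h\in\mathrm{SL}_d(\mathcal R)$ such that $$ugh=\mathrm{diag}\big\{x^{\log_q\lambda_1(\Lambda)},\dots,x^{\log_q\lambda_d(\Lambda)}\big\}.$$
   Context: Let $q$ be a prime power, $\mathcal R=\mathbb F_q[x]$, and $\tilde{\mathcal K}=\mathbb F_q((x^{-1}))$, with the absolute value $|\cdot|$ extending $|f|=q^{\deg f}$ for nonzero $f\in\mathcal R$ (and $|0|=0$); $\mathcal O=\mathbb F_q[[x^{-1}]]=\{f\in\tilde{\mathcal K}:|f|\le1\}$. Convention of the paper: $\mathrm{SL}_d(\tilde{\mathcal K})$ denotes the group of invertible $d\times d$ matrices over $\tilde{\mathcal K}$ with $|\det(g)|=1$ (determinant of absolute value one, not necessarily equal to one); likewise $\mathrm{SL}_d(\mathcal R)$ and $\mathrm{SL}_d(\mathcal O)$ denote the groups of $d\times d$ matrices with entries in $\mathcal R$, respectively $\mathcal O$, whose determinant has absolute value $1$. On $\tilde{\mathcal K}^d$ use the norm $\|\mathbf v\|=\max_i|v_i|$. For a lattice $\Lambda=g\mathcal R^d$ and $i=1,\dots,d$, $\lambda_i(\Lambda)=\min\{r>0:\text{ there exist } i \text{ linearly independent vectors in }\Lambda\text{ of norm}\le r\}$, which is an integer power of $q$. *)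

theory Defs
  imports
    "HOL-Computational_Algebra.Formal_Laurent_Series"
    "HOL-Library.Cardinality"
    "Jordan_Normal_Form.VS_Connect"
begin

(* The finite field F_q is a type 'a::{field,finite}, so q = CARD('a).
   The field F_q((1/x)) is the type 'a fls, where the library's variable fls_X stands for 1/x;
   hence x itself is fls_X_inv. *)

definition fls_abs :: "'a::{field,finite} fls \<Rightarrow> real" where
  "fls_abs f = (if f = 0 then 0 else real CARD('a) powi (- fls_subdegree f))"

definition fls_of_poly :: "'a::field poly \<Rightarrow> 'a fls" where
  "fls_of_poly p = poly (map_poly fls_const p) fls_X_inv"

definition poly_subring :: "'a::field fls set" where
  "poly_subring = range fls_of_poly"

definition integer_subring :: "'a::{field,finite} fls set" where
  "integer_subring = {f. fls_abs f \<le> 1}"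

(* Only the absolute value of the determinant is required to be one. *)
definition SL_over :: "nat \<Rightarrow> 'a::{field,finite} fls set \<Rightarrow> 'a fls mat set" where
  "SL_over d A = {M \<in> carrier_mat d d. elements_mat M \<subseteq> A \<and> fls_abs (det M) = 1}"

(* intended for vectors of positive dimension *)
definition vec_max_norm :: "'a::{field,finite} fls vec \<Rightarrow> real" where
  "vec_max_norm v = Max (fls_abs ` set\<^sub>v v)"

definition lattice_of :: "nat \<Rightarrow> 'a::field fls mat \<Rightarrow> 'a fls vec set" where
  "lattice_of d g = {g *\<^sub>v v | v. v \<in> carrier_vec d \<and> set\<^sub>v v \<subseteq> poly_subring}"

(* Linear independence is over the field F_q((1/x)). *)
definition successive_min :: "nat \<Rightarrow> 'a::{field,finite} fls vec set \<Rightarrow> nat \<Rightarrow> real" where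
  "successive_min d L i =
     (LEAST r. r > 0 \<and>
        (\<exists>S \<subseteq> L. finite S \<and> card S = i
           \<and> LinearCombinations.module.lin_indpt class_ring (module_vec TYPE('a fls) d) S
           \<and> (\<forall>v\<in>S. vec_max_norm v \<le> r)))"

lemma fls_of_poly_nth:
  "fls_nth (fls_of_poly p) n = (if n \<le> 0 then coeff p (nat (- n)) else 0)"
proof (induction p arbitrary: n)
  case 0
  then show ?case by (simp add: fls_of_poly_def)
next
  case (pCons a p)
  have "fls_of_poly (pCons a p) = fls_const a + fls_shift 1 (fls_of_poly p)"
    using pCons.hyps
    by (simp add: fls_of_poly_def map_poly_pCons fls_X_inv_times_conv_shift)
  then have "fls_nth (fls_of_poly (pCons a p)) n =
      (if n = 0 then a else 0) + fls_nth (fls_of_poly p) (n + 1)"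
    by simp
  also have "\<dots> = (if n \<le> 0 then coeff (pCons a p) (nat (- n)) else 0)"
  proof (cases "n < 0")
    case True
    then have "nat (- n) = Suc (nat (- (n + 1)))" by simp
    with True show ?thesis by (simp add: pCons.IH)
  qed (auto simp: pCons.IH)
  finally show ?case .
qed

lemma fls_abs_of_poly:
  fixes p :: "'a::{field,finite} poly"
  shows "fls_abs (fls_of_poly p) = (if p = 0 then 0 else real CARD('a) ^ degree p)"
proof (cases "p = 0")
  case True
  then show ?thesis by (simp add: fls_abs_def fls_of_poly_def)
next
  case False
  have "fls_nth (fls_of_poly p) (- int (degree p)) \<noteq> 0"
    using False by (simp add: fls_of_poly_nth)
  moreover have "fls_nth (fls_of_poly p) k = 0" if "k < - int (degree p)" for k
    using that by (auto simp: fls_of_poly_nth intro!: coeff_eq_0)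
  ultimately have "fls_subdegree (fls_of_poly p) = - int (degree p)" "fls_of_poly p \<noteq> 0"
    by (auto intro!: fls_subdegree_eqI)
  with False show ?thesis by (simp add: fls_abs_def)
qed

end

theory Submission
  imports Defs "Jordan_Normal_Form.Char_Poly"
begin

text \<open>
  The idea is basis reduction. Write the given matrix as \<open>C * D\<close>, where \<open>C\<close> is integral
  (its entries lie in \<open>\<O>\<close>) and \<open>D\<close> is a diagonal matrix of powers of \<open>x\<close>; a sufficiently high
  common power of \<open>x\<close> does this. If \<open>det C\<close> is a unit of \<open>\<O>\<close>, then \<open>C\<close> is invertible over \<open>\<O>\<close>,
  and \<open>u = C\<^sup>-\<^sup>1\<close> leaves only \<open>D\<close>. Otherwise the columns of \<open>C\<close> are linearly dependent modulo the
  maximal ideal, with coefficients in the residue field \<open>F\<^sub>q\<close>. Among the columns occurring in such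
  a dependency take one whose power of \<open>x\<close> is largest: the multiples of the other columns needed
  to realise the dependency on the lattice basis \<open>C * D\<close> are then polynomial multiples, so a
  unimodular column operation lets the chosen exponent in \<open>D\<close> drop by one while \<open>C\<close> stays
  integral. This lowers the valuation of \<open>det C\<close> by one, and so the process stops
  (\<open>unimodular_reduction_step\<close>, \<open>unimodular_reduction\<close>). A permutation of the columns puts the
  exponents in increasing order (\<open>unimodular_reduction_sorted\<close>).

  It remains to see that the exponents are those of the successive minima
  (\<open>successive_min_reduced\<close>). A matrix invertible over \<open>\<O>\<close> does not change norms, so the \<open>j\<close>-th
  basis vector has norm \<open>q\<close> to the power \<open>k j\<close>, and a lattice vector in which it occurs with nonzero
  polynomial coefficient has at least this norm, because there is no cancellation between
  different coordinates in the maximum norm. So the vectors of norm below \<open>q\<close> to the power \<open>k i\<close>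
  lie in the span of the first \<open>i\<close> basis vectors, and fewer than \<open>i + 1\<close> of them are independent.
\<close>

(* The infix dollar sign is to denote the entries of vectors. *)
unbundle no fps_syntax

section \<open>Two subrings of the field of Laurent series\<close>

text \<open>
  Both \<open>\<O>\<close> and the ring of polynomials in \<open>x\<close> are images of rings that exist as types. Computing
  with matrices over these types makes integrality automatic, and makes determinants and
  adjugates available inside the subring.
\<close>

interpretation fps_fls: inj_comm_ring_hom "fps_to_fls :: 'a::field fps \<Rightarrow> 'a fls"
  by unfold_locales (auto simp: fls_times_fps_to_fls)

text \<open>The constant coefficient is the reduction of \<open>\<O>\<close> modulo its maximal ideal.\<close>

interpretation fps_residue: comm_ring_hom "\<lambda>f :: 'a::field fps. fps_nth f 0"
  by unfold_locales auto

interpretation fls_const_hom: comm_ring_hom "fls_const :: 'a::field \<Rightarrow> 'a fls"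
  by unfold_locales (auto simp: fls_plus_const)

interpretation poly_fls: comm_ring_hom "fls_of_poly :: 'a::field poly \<Rightarrow> 'a fls"
proof -
  interpret map_poly_comm_ring_hom "fls_const :: 'a \<Rightarrow> 'a fls" ..
  show "comm_ring_hom (fls_of_poly :: 'a poly \<Rightarrow> 'a fls)"
    by unfold_locales (auto simp: fls_of_poly_def hom_distribs)
qed

lemma fls_of_poly_monom:
  "fls_of_poly (monom c n) = fls_const c * fls_X_inv powi int n"
  by (simp add: fls_of_poly_def map_poly_monom poly_monom)

lemma card_field_gt_1: "real CARD('a::{field,finite}) > 1"
proof -
  have "card {0, 1 :: 'a} \<le> CARD('a)" by (intro card_mono) auto
  thus ?thesis by simp
qed

lemma fls_abs_nonneg: "0 \<le> fls_abs f"
  by (simp add: fls_abs_def)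

lemma fls_abs_mult: "fls_abs (f * g) = fls_abs f * fls_abs (g :: 'a::{field,finite} fls)"
  using card_field_gt_1[where 'a='a]
  by (simp add: fls_abs_def power_int_diff power_int_minus divide_inverse)

lemma fls_abs_one: "fls_abs (1 :: 'a::{field,finite} fls) = 1"
  by (simp add: fls_abs_def)

lemma fls_abs_add_le_max:
  "fls_abs (f + g) \<le> max (fls_abs f) (fls_abs (g :: 'a::{field,finite} fls))"
proof (cases "f = 0 \<or> g = 0 \<or> f + g = 0")
  case True
  thus ?thesis
    by (auto simp: fls_abs_def le_max_iff_disj)
next
  case False
  hence "fls_subdegree f \<le> fls_subdegree (f + g) \<or> fls_subdegree g \<le> fls_subdegree (f + g)"
    using fls_plus_subdegree[of f g] by linarith
  thus ?thesis
    using False card_field_gt_1[where 'a='a]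
    by (auto simp: fls_abs_def le_max_iff_disj intro: power_int_increasing)
qed

lemma fls_abs_sum_le:
  assumes "\<And>i. i \<in> A \<Longrightarrow> fls_abs (f i) \<le> r" "0 \<le> r"
  shows "fls_abs (\<Sum>i\<in>A. f i) \<le> r"
  using assms
proof (induction A rule: infinite_finite_induct)
  case (insert x A)
  thus ?case using fls_abs_add_le_max[of "f x" "\<Sum>i\<in>A. f i"] by fastforce
qed (auto simp: fls_abs_def)

lemma fls_abs_X_inv_powi:
  "fls_abs (fls_X_inv powi n :: 'a::{field,finite} fls) = real CARD('a) powi n"
  by (simp add: fls_abs_def)

lemma fls_abs_fps_le_1: "fls_abs (fps_to_fls f :: 'a::{field,finite} fls) \<le> 1"
  using card_field_gt_1[where 'a='a]
  by (auto simp: fls_abs_def fls_subdegree_fls_to_fps power_int_minus field_simps)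

text \<open>
  The discreteness of the polynomial ring: this is what bounds the norms of lattice vectors from
  below.
\<close>

lemma fls_abs_poly_ge_1:
  assumes "fls_of_poly p \<noteq> (0 :: 'a::{field,finite} fls)"
  shows "fls_abs (fls_of_poly p :: 'a fls) \<ge> 1"
proof -
  have "p \<noteq> 0" using assms by auto
  thus ?thesis using card_field_gt_1[where 'a='a] by (simp add: fls_abs_of_poly)
qed

text \<open>A unit and its inverse both have absolute value at most one, and the product is one.\<close>

lemma fls_abs_unit_fps:
  assumes "f dvd 1"
  shows "fls_abs (fps_to_fls f :: 'a::{field,finite} fls) = 1"
proof -
  obtain e where "1 = f * e" using assms by (rule dvdE)
  hence "fps_to_fls f * fps_to_fls e = 1" by (metis fps_fls.hom_mult fps_fls.hom_one)
  hence "fls_abs (fps_to_fls f) * fls_abs (fps_to_fls e) = 1"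
    by (metis fls_abs_mult fls_abs_one)
  thus ?thesis
    using fls_abs_fps_le_1[of f] fls_abs_fps_le_1[of e] fls_abs_nonneg[of "fps_to_fls f"]
      mult_left_le[of "fls_abs (fps_to_fls e)" "fls_abs (fps_to_fls f)"]
    by linarith
qed

lemma fls_abs_unit_poly:
  assumes "p dvd 1"
  shows "fls_abs (fls_of_poly p :: 'a::{field,finite} fls) = 1"
  using assms by (auto simp: fls_abs_of_poly is_unit_iff_degree)

lemma vec_max_norm_le_iff:
  assumes "0 < dim_vec v"
  shows "vec_max_norm v \<le> r \<longleftrightarrow> (\<forall>i<dim_vec v. fls_abs (v $ i) \<le> r)"
  unfolding vec_max_norm_def vec_set_def using assms by (subst Max_le_iff) auto

section \<open>Invertible matrices over the two subrings\<close>

text \<open>The inverse is the adjugate divided by the determinant.\<close>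

lemma inverse_mat_of_unit_det:
  fixes A :: "'a::comm_ring_1 mat"
  assumes A: "A \<in> carrier_mat n n" and "det A dvd 1"
  obtains B where "B \<in> carrier_mat n n" "A * B = 1\<^sub>m n" "B * A = 1\<^sub>m n" "det B dvd 1"
proof -
  obtain c where c: "1 = det A * c" using assms(2) by (rule dvdE)
  define B where "B = c \<cdot>\<^sub>m adj_mat A"
  note adj = adj_mat[OF A]
  have "A * B = c \<cdot>\<^sub>m (A * adj_mat A)" "B * A = c \<cdot>\<^sub>m (adj_mat A * A)"
    unfolding B_def using A adj(1)
    by (auto simp: mult_smult_distrib mult_smult_assoc_mat)
  hence inv: "A * B = 1\<^sub>m n" "B * A = 1\<^sub>m n"
    using adj(2,3) c by (auto simp: mult.commute)
  have B: "B \<in> carrier_mat n n" unfolding B_def using adj(1) by simp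
  have "det A * det B = 1" using inv(1) det_mult[OF A B] by simp
  hence "det B dvd 1" by (metis dvd_triv_right)
  thus thesis using that B inv by blast
qed

lemma SL_over_fps:
  assumes "U \<in> carrier_mat d d" "det U dvd 1"
  shows "map_mat fps_to_fls U \<in> SL_over d integer_subring"
  using assms fls_abs_unit_fps
  by (auto simp: SL_over_def integer_subring_def fls_abs_fps_le_1)

lemma SL_over_poly:
  assumes "H \<in> carrier_mat d d" "det H dvd 1"
  shows "map_mat fls_of_poly H \<in> SL_over d poly_subring"
  using assms fls_abs_unit_poly
  by (auto simp: SL_over_def poly_subring_def)

lemma lattice_of_poly:
  "lattice_of d g = {g *\<^sub>v map_vec fls_of_poly p | p. p \<in> carrier_vec d}"
proof -
  have "\<exists>p \<in> carrier_vec d. v = map_vec fls_of_poly p"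
    if "v \<in> carrier_vec d" "set\<^sub>v v \<subseteq> poly_subring" for v :: "'a fls vec"
  proof -
    have "\<forall>i<d. \<exists>p. v $ i = fls_of_poly p"
      using that by (auto simp: vec_set_def poly_subring_def)
    then obtain p where "\<forall>i<d. v $ i = fls_of_poly (p i)" by metis
    thus ?thesis using that by (intro bexI[of _ "vec d p"]) auto
  qed
  moreover have "set\<^sub>v (map_vec fls_of_poly p) \<subseteq> poly_subring" for p :: "'a poly vec"
    by (auto simp: poly_subring_def)
  ultimately show ?thesis
    unfolding lattice_of_def by (smt (verit) Collect_cong map_carrier_vec)
qed

text \<open>A unimodular change of basis: \<open>H\<close> permutes the polynomial vectors.\<close>

lemma lattice_of_mult_unimodular:
  assumes g: "g \<in> carrier_mat d d" and H: "H \<in> carrier_mat d d" "det H dvd 1"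
  shows "lattice_of d (g * map_mat fls_of_poly H) = lattice_of d g"
proof -
  obtain B where B: "B \<in> carrier_mat d d" "H * B = 1\<^sub>m d"
    using inverse_mat_of_unit_det[OF H] by metis
  have eq: "g * map_mat fls_of_poly H *\<^sub>v map_vec fls_of_poly p
      = g *\<^sub>v map_vec fls_of_poly (H *\<^sub>v p)" if "p \<in> carrier_vec d" for p
    using that g H by (simp add: poly_fls.mult_mat_vec_hom)
  have "g *\<^sub>v map_vec fls_of_poly p = g * map_mat fls_of_poly H *\<^sub>v map_vec fls_of_poly (B *\<^sub>v p)"
    if p: "p \<in> carrier_vec d" for p
  proof -
    have "H *\<^sub>v (B *\<^sub>v p) = p" using p B H by (metis assoc_mult_mat_vec one_mult_mat_vec)
    thus ?thesis using eq[of "B *\<^sub>v p"] p B by simp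
  qed
  moreover have "B *\<^sub>v p \<in> carrier_vec d" "H *\<^sub>v p \<in> carrier_vec d" if "p \<in> carrier_vec d" for p
    using that B H by auto
  ultimately show ?thesis unfolding lattice_of_poly using eq by (auto; metis)
qed

section \<open>Reduction of a basis\<close>

lemma det_mat_diag: "det (mat_diag n f) = (\<Prod>i<n. f i)"
proof -
  have "det (mat_diag n f) = prod_list (diag_mat (mat_diag n f))"
    by (rule det_upper_triangular[of _ n]) (auto simp: mat_diag_def)
  thus ?thesis
    by (simp add: prod_list_diag_prod mat_diag_def atLeast0LessThan)
qed

text \<open>
  Let \<open>a\<close> be a nonzero vector over the residue field that \<open>C\<close> maps to zero modulo \<open>1/x\<close>, and \<open>j\<close> an
  index with \<open>a $ j \<noteq> 0\<close> for which \<open>k j\<close> is largest. Adding the columns of \<open>C * D\<close> with coefficients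
  \<open>a $ i * x ^ (k j - k i)\<close>, which are polynomials by the choice of \<open>j\<close>, produces \<open>C a\<close> times
  \<open>x\<close> to the power \<open>k j\<close>. Since \<open>C a\<close> is divisible by \<open>1/x\<close>, this is an integral vector \<open>y\<close> times
  \<open>x\<close> to the power \<open>k j - 1\<close>, and \<open>y\<close> becomes the new column \<open>j\<close> of the integral matrix.
  The determinants of both the column operation and the new integral matrix come from Cramer's rule.
\<close>

lemma unimodular_reduction_step:
  fixes C :: "'a::field fps mat" and k :: "nat \<Rightarrow> int"
  assumes C: "C \<in> carrier_mat d d" and nz: "det C \<noteq> 0" and res0: "fps_nth (det C) 0 = 0"
  obtains C' k' E where "C' \<in> carrier_mat d d" "subdegree (det C') < subdegree (det C)"
    "det C' \<noteq> 0" "E \<in> carrier_mat d d" "det E dvd 1"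
    "map_mat fps_to_fls C * mat_diag d (\<lambda>i. fls_X_inv powi k i) * map_mat fls_of_poly E
      = map_mat fps_to_fls C' * mat_diag d (\<lambda>i. fls_X_inv powi k' i)"
proof -
  let ?C0 = "map_mat (\<lambda>f. fps_nth f 0) C"
  have "det ?C0 = 0" using res0 by simp
  then obtain a where a: "a \<in> carrier_vec d" "a \<noteq> 0\<^sub>v d" "?C0 *\<^sub>v a = 0\<^sub>v d"
    using det_0_iff_vec_prod_zero[of ?C0 d] C by auto
  define J where "J = {i. i < d \<and> a $ i \<noteq> 0}"
  have "J \<noteq> {}"
    using a(1,2) by (auto simp: J_def)
  moreover have finJ: "finite J" by (simp add: J_def)
  ultimately have "Max (k ` J) \<in> k ` J" by (intro Max_in) auto
  then obtain j where j: "j \<in> J" and "k j = Max (k ` J)" by auto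
  hence k_max: "k i \<le> k j" if "i \<in> J" for i using that finJ by simp
  have jd: "j < d" and aj: "a $ j \<noteq> 0" using j by (auto simp: J_def)
  define b where "b = C *\<^sub>v map_vec fps_const a"
  have b: "b \<in> carrier_vec d" unfolding b_def using C a(1) by auto
  have b_sum: "b $ r = (\<Sum>i<d. C $$ (r, i) * fps_const (a $ i))" if "r < d" for r
    unfolding b_def using that C a(1)
    by (auto simp: scalar_prod_def atLeast0LessThan)
  have b_res: "fps_nth (b $ r) 0 = 0" if "r < d" for r
  proof -
    have "fps_nth (b $ r) 0 = (?C0 *\<^sub>v a) $ r"
      using that C a(1) by (auto simp: b_sum scalar_prod_def atLeast0LessThan fps_sum_nth)
    thus ?thesis using a(3) that by simp
  qed
  define y where "y = vec d (\<lambda>r. fps_shift 1 (b $ r))"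
  have y_X: "y $ r * fps_X = b $ r" if "r < d" for r
    using that b_res[OF that] by (intro fps_ext) (auto simp: y_def)
  define C' where "C' = replace_col C y j"
  have C': "C' \<in> carrier_mat d d" unfolding C'_def using C by (auto simp: replace_col_def)
  (* Multiplying the new column by 1/x turns it back into a combination of the columns of C. *)
  have "C' * mat_diag d (\<lambda>i. if i = j then fps_X else 1) = replace_col C b j"
    by (subst mat_diag_mult_right[OF C']) (use C y_X in \<open>auto simp: C'_def replace_col_def\<close>)
  hence "det C' * det (mat_diag d (\<lambda>i. if i = j then fps_X else 1 :: 'a fps)) = det (replace_col C b j)"
    using det_mult[OF C' mat_diag_dim] by metis
  also have "\<dots> = fps_const (a $ j) * det C"
    unfolding b_def using cramer_lemma_mat[OF C, of "map_vec fps_const a" j] a(1) jd by simp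
  also have "det (mat_diag d (\<lambda>i. if i = j then fps_X else 1 :: 'a fps)) = fps_X"
    using jd by (simp add: det_mat_diag prod.delta)
  finally have det_C': "det C' * fps_X = fps_const (a $ j) * det C" .
  have nz': "det C' \<noteq> 0" using det_C' nz aj by auto
  have "subdegree (det C') < subdegree (det C)"
    using arg_cong[OF det_C', of subdegree] nz nz' aj by simp
  define e where "e = vec d (\<lambda>i. if i \<in> J then monom (a $ i) (nat (k j - k i)) else 0)"
  have e: "e \<in> carrier_vec d" by (simp add: e_def)
  define E where "E = replace_col (1\<^sub>m d) e j"
  have E: "E \<in> carrier_mat d d" unfolding E_def by (auto simp: replace_col_def)
  have "det E = e $ j"
    unfolding E_def using cramer_lemma_mat[of "1\<^sub>m d" d e j] e jd by simp
  hence "det E dvd 1"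
    using j jd aj by (simp add: e_def monom_0)
  define k' where "k' = k(j := k j - 1)"
  let ?D = "mat_diag d (\<lambda>i. fls_X_inv powi k i) :: 'a fls mat"
  have CD: "map_mat fps_to_fls C * ?D = mat d d (\<lambda>(r, i). fps_to_fls (C $$ (r, i)) * fls_X_inv powi k i)"
    by (subst mat_diag_mult_right[of _ d]) (use C in auto)
  have entry: "(map_mat fps_to_fls C * ?D * map_mat fls_of_poly E) $$ (r, s)
      = (\<Sum>i<d. fps_to_fls (C $$ (r, i)) * fls_X_inv powi k i * fls_of_poly (E $$ (i, s)))"
    if "r < d" "s < d" for r s
    unfolding CD using that E by (auto simp: scalar_prod_def atLeast0LessThan)
  have X: "fps_to_fls fps_X * fls_X_inv powi n = (fls_X_inv powi (n - 1) :: 'a fls)" for n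
    by (simp add: power_int_diff fls_inverse_X_inv divide_inverse mult.commute)
  have "map_mat fps_to_fls C * ?D * map_mat fls_of_poly E
      = map_mat fps_to_fls C' * mat_diag d (\<lambda>i. fls_X_inv powi k' i)" (is "?L = ?R")
  proof (rule eq_matI)
    fix r s assume "r < dim_row ?R" "s < dim_col ?R"
    hence rs: "r < d" "s < d" using C' by (auto simp: mat_diag_def)
    have R: "?R $$ (r, s) = fps_to_fls (C' $$ (r, s)) * fls_X_inv powi k' s"
      by (subst mat_diag_mult_right[of _ d]) (use C' rs in auto)
    show "?L $$ (r, s) = ?R $$ (r, s)"
    proof (cases "s = j")
      case False
      have "?L $$ (r, s) = (\<Sum>i<d. if i = s then fps_to_fls (C $$ (r, i)) * fls_X_inv powi k i else 0)"
        unfolding entry[OF rs] using False rs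
        by (intro sum.cong) (auto simp: E_def replace_col_def)
      thus ?thesis unfolding R using False rs C by (simp add: C'_def replace_col_def k'_def)
    next
      case True
      have col: "fps_to_fls (C $$ (r, i)) * fls_X_inv powi k i * fls_of_poly (E $$ (i, j))
          = fps_to_fls (C $$ (r, i) * fps_const (a $ i)) * fls_X_inv powi k j" if "i < d" for i
      proof (cases "i \<in> J")
        case True
        hence "fls_X_inv powi k i * fls_X_inv powi int (nat (k j - k i)) = (fls_X_inv powi k j :: 'a fls)"
          using k_max[OF True] by (simp flip: power_int_add)
        thus ?thesis
          using True that jd
          by (simp add: E_def replace_col_def e_def fls_of_poly_monom fls_times_fps_to_fls ac_simps)
      next
        case False
        thus ?thesis using that jd by (simp add: E_def replace_col_def e_def J_def)
      qed
      have "?L $$ (r, s) = fps_to_fls (b $ r) * fls_X_inv powi k j"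
        unfolding True entry[OF rs(1) jd] b_sum[OF rs(1)] fps_fls.hom_sum sum_distrib_right
        using col by (intro sum.cong) auto
      also have "\<dots> = fps_to_fls (y $ r) * (fps_to_fls fps_X * fls_X_inv powi k j)"
        using y_X[OF rs(1), symmetric] by (simp add: fls_times_fps_to_fls)
      also have "\<dots> = ?R $$ (r, s)"
        unfolding R X using True rs C by (simp add: C'_def replace_col_def k'_def)
      finally show ?thesis .
    qed
  qed (use C C' E in \<open>auto simp: mat_diag_def\<close>)
  from that[OF C' \<open>subdegree (det C') < subdegree (det C)\<close> nz' E \<open>det E dvd 1\<close> this]
  show thesis .
qed

text \<open>
  The valuation of \<open>det C\<close> decreases with every step, and the process can be continued until it
  is zero, which means that \<open>C\<close> is invertible over \<open>\<O>\<close>.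
\<close>

lemma unimodular_reduction:
  fixes C :: "'a::field fps mat" and k :: "nat \<Rightarrow> int"
  assumes "C \<in> carrier_mat d d" "det C \<noteq> 0"
  shows "\<exists>U k' H. U \<in> carrier_mat d d \<and> det U dvd 1 \<and> H \<in> carrier_mat d d \<and> det H dvd 1 \<and>
    map_mat fps_to_fls C * mat_diag d (\<lambda>i. fls_X_inv powi k i) * map_mat fls_of_poly H
      = map_mat fps_to_fls U * mat_diag d (\<lambda>i. fls_X_inv powi k' i)"
  using assms
proof (induction "subdegree (det C)" arbitrary: C k rule: less_induct)
  case less
  let ?D = "\<lambda>k. mat_diag d (\<lambda>i. fls_X_inv powi k i) :: 'a fls mat"
  show ?case
  proof (cases "fps_nth (det C) 0 = 0")
    case True
    then obtain C' k' E where step: "C' \<in> carrier_mat d d" "subdegree (det C') < subdegree (det C)"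
      "det C' \<noteq> 0" "E \<in> carrier_mat d d" "det E dvd 1"
      "map_mat fps_to_fls C * ?D k * map_mat fls_of_poly E = map_mat fps_to_fls C' * ?D k'"
      by (rule unimodular_reduction_step[OF less.prems])
    obtain U l H where
      IH: "U \<in> carrier_mat d d" "det U dvd 1" "H \<in> carrier_mat d d" "det H dvd 1"
      "map_mat fps_to_fls C' * ?D k' * map_mat fls_of_poly H = map_mat fps_to_fls U * ?D l"
      using less.hyps[OF step(2,1,3), of k'] by blast
    have "map_mat fps_to_fls C * ?D k \<in> carrier_mat d d"
      using less.prems by auto
    hence "map_mat fps_to_fls C * ?D k * map_mat fls_of_poly (E * H) = map_mat fps_to_fls U * ?D l"
      using step(4) IH(3) by (simp add: poly_fls.mat_hom_mult flip: IH(5) step(6))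
    moreover have "det (E * H) dvd 1" 
      using det_mult[OF step(4) IH(3)] step(5) IH(4) by (metis is_unit_mult_iff)
    moreover have "E * H \<in> carrier_mat d d" using step(4) IH(3) by simp
    ultimately show ?thesis using IH(1,2) by blast
  next
    case False
    hence "det C dvd 1" by (simp add: fps_is_unit_iff)
    moreover have "map_mat fps_to_fls C * ?D k * map_mat fls_of_poly (1\<^sub>m d)
        = map_mat fps_to_fls C * ?D k"
      using less.prems by (simp add: poly_fls.mat_hom_one mat_diag_def)
    ultimately show ?thesis using less.prems
      by (intro exI[of _ C] exI[of _ k] exI[of _ "1\<^sub>m d"]) auto
  qed
qed

definition perm_mat :: "nat \<Rightarrow> (nat \<Rightarrow> nat) \<Rightarrow> 'a::zero_neq_one mat" where
  "perm_mat d p = mat d d (\<lambda>(i, j). if i = p j then 1 else 0)"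

lemma perm_mat_carrier [simp]: "perm_mat d p \<in> carrier_mat d d"
  by (simp add: perm_mat_def)

lemma mult_perm_mat:
  fixes A :: "'a::comm_ring_1 mat"
  assumes "A \<in> carrier_mat n d" "p ` {..<d} \<subseteq> {..<d}"
  shows "A * perm_mat d p = mat n d (\<lambda>(i, j). A $$ (i, p j))"
proof (rule eq_matI)
  fix i j assume "i < dim_row (mat n d (\<lambda>(i, j). A $$ (i, p j)))" "j < dim_col (mat n d (\<lambda>(i, j). A $$ (i, p j)))"
  hence ij: "i < n" "j < d" by auto
  have "(A * perm_mat d p) $$ (i, j) = (\<Sum>l<d. A $$ (i, l) * (if l = p j then 1 else 0))"
    using assms(1) ij by (simp add: perm_mat_def scalar_prod_def atLeast0LessThan)
  also have "\<dots> = (\<Sum>l<d. if l = p j then A $$ (i, l) else 0)"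
    by (intro sum.cong) auto
  finally have "(A * perm_mat d p) $$ (i, j) = (\<Sum>l<d. if l = p j then A $$ (i, l) else 0)" .
  thus "(A * perm_mat d p) $$ (i, j) = mat n d (\<lambda>(i, j). A $$ (i, p j)) $$ (i, j)"
    using ij assms(2) by (auto simp: image_subset_iff)
qed (use assms in \<open>auto simp: perm_mat_def\<close>)

text \<open>A permutation matrix is inverted by its transpose.\<close>

lemma det_perm_mat_unit:
  assumes "bij_betw p {..<d} {..<d}"
  shows "det (perm_mat d p :: 'a::comm_ring_1 mat) dvd 1"
proof -
  let ?P = "perm_mat d p :: 'a mat"
  have P: "?P \<in> carrier_mat d d" "transpose_mat ?P \<in> carrier_mat d d" by simp_all
  have "transpose_mat ?P * ?P = mat d d (\<lambda>(i, j). transpose_mat ?P $$ (i, p j))"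
    using assms by (intro mult_perm_mat) (auto simp: bij_betw_def)
  also have "\<dots> = 1\<^sub>m d"
  proof (rule eq_matI)
    fix i j assume "i < dim_row (1\<^sub>m d :: 'a mat)" "j < dim_col (1\<^sub>m d :: 'a mat)"
    moreover from this have "p j < d" "p j = p i \<longleftrightarrow> j = i"
      using assms by (auto simp: bij_betw_def inj_on_def)
    ultimately show "mat d d (\<lambda>(i, j). transpose_mat ?P $$ (i, p j)) $$ (i, j) = 1\<^sub>m d $$ (i, j)"
      by (auto simp: perm_mat_def)
  qed simp_all
  finally have "det (transpose_mat ?P) * det ?P = 1"
    using det_mult[OF P(2,1)] by simp
  thus ?thesis by (metis dvd_triv_right)
qed

lemma ex_sorting_permutation:
  fixes k :: "nat \<Rightarrow> 'a::linorder"
  obtains p where "bij_betw p {..<d} {..<d}" "mono_on {..<d} (k \<circ> p)"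
proof -
  define xs where "xs = sort_key k [0..<d]"
  have xs: "length xs = d" "distinct xs" "set xs = {..<d}" "sorted (map k xs)"
    by (auto simp: xs_def)
  have "bij_betw (\<lambda>i. xs ! i) {..<d} {..<d}" using xs by (intro bij_betw_nth) auto
  moreover have "mono_on {..<d} (k \<circ> (\<lambda>i. xs ! i))"
    using xs by (intro mono_onI) (auto simp: sorted_iff_nth_mono)
  ultimately show thesis using that by blast
qed

lemma unimodular_reduction_sorted:
  fixes g :: "'a::field fls mat"
  assumes g: "g \<in> carrier_mat d d" and nz: "det g \<noteq> 0"
  obtains U k H where "U \<in> carrier_mat d d" "det U dvd 1" "H \<in> carrier_mat d d" "det H dvd 1"
    "mono_on {..<d} (k :: nat \<Rightarrow> int)"
    "g * map_mat fls_of_poly H = map_mat fps_to_fls U * mat_diag d (\<lambda>i. fls_X_inv powi k i)"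
proof -
  let ?D = "\<lambda>k. mat_diag d (\<lambda>i. fls_X_inv powi k i) :: 'a fls mat"
  (* The power of x is chosen so that dividing g by it makes all entries integral. The zero
     keeps the maximum defined when d = 0. *)
  define N where "N = Max (insert 0 ((\<lambda>f. - fls_subdegree f) ` elements_mat g))"
  have N: "- fls_subdegree (g $$ (i, j)) \<le> N" if "i < d" "j < d" for i j
    unfolding N_def using g that by (intro Max_ge) (auto intro!: imageI simp: elements_mat_def)
  define C where "C = map_mat (\<lambda>f. fls_regpart (f * fls_X_intpow N)) g"
  have C: "C \<in> carrier_mat d d" using g by (simp add: C_def)
  have entry: "fps_to_fls (fls_regpart (f * fls_X_intpow N)) * fls_X_inv powi N = f"
    if "- fls_subdegree f \<le> N" for f :: "'a fls"
  proof (cases "f = 0")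
    case False
    have "fls_subdegree (f * fls_X_intpow N) \<ge> 0" using that False by simp
    hence "fps_to_fls (fls_regpart (f * fls_X_intpow N)) * fls_X_inv powi N
        = f * (fls_X powi N * fls_X_inv powi N)"
      by (simp add: fls_regpart_to_fls_trivial mult.assoc)
    also have "fls_X powi N * fls_X_inv powi N = (1 :: 'a fls)"
      by (simp add: fls_inverse_X [symmetric] power_int_inverse del: fls_X_power_int)
    finally show ?thesis by simp
  qed simp
  have g_eq: "g = map_mat fps_to_fls C * ?D (\<lambda>_. N)"
    by (subst mat_diag_mult_right[of _ d]) (use C g N entry in \<open>auto simp: C_def\<close>)
  have "det C \<noteq> 0"
  proof
    assume "det C = 0"
    hence "det (map_mat fps_to_fls C) = 0" by simp
    hence "det g = 0" using det_mult[of "map_mat fps_to_fls C" d "?D (\<lambda>_. N)"] C g_eq by simp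
    thus False using nz by simp
  qed
  from unimodular_reduction[OF C this, of "\<lambda>_. N"] obtain U k H where
    UH: "U \<in> carrier_mat d d" "det U dvd 1" "H \<in> carrier_mat d d" "det H dvd 1"
    and eq: "g * map_mat fls_of_poly H = map_mat fps_to_fls U * ?D k"
    unfolding g_eq[symmetric] by blast
  obtain p where p: "bij_betw p {..<d} {..<d}" "mono_on {..<d} (k \<circ> p)"
    by (rule ex_sorting_permutation)
  have p_im: "p ` {..<d} \<subseteq> {..<d}" using p(1) by (simp add: bij_betw_def)
  have hom: "map_mat fls_of_poly (perm_mat d p) = (perm_mat d p :: 'a fls mat)"
    by (auto simp: perm_mat_def)
  have "g * map_mat fls_of_poly (H * perm_mat d p) = g * map_mat fls_of_poly H * perm_mat d p"
    unfolding poly_fls.mat_hom_mult[OF UH(3) perm_mat_carrier] hom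
    using g UH(3) by (intro assoc_mult_mat[symmetric, of _ d d _ d _ d]) auto
  also have "\<dots> = mat d d (\<lambda>(i, j). fps_to_fls (U $$ (i, p j)) * fls_X_inv powi k (p j))"
    unfolding eq using UH(1) p_im
    by (subst mult_perm_mat[of _ d], simp, simp, subst mat_diag_mult_right[of _ d]) (auto simp: image_subset_iff)
  also have "\<dots> = map_mat fps_to_fls (U * perm_mat d p) * ?D (k \<circ> p)"
    using UH(1) p_im by (subst mat_diag_mult_right[of _ d]) (auto simp: mult_perm_mat image_subset_iff)
  finally have "g * map_mat fls_of_poly (H * perm_mat d p)
      = map_mat fps_to_fls (U * perm_mat d p) * ?D (k \<circ> p)" .
  moreover have "det (U * perm_mat d p) dvd 1" "det (H * perm_mat d p) dvd 1"
    using UH det_perm_mat_unit[OF p(1)] det_mult[OF UH(1) perm_mat_carrier]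
      det_mult[OF UH(3) perm_mat_carrier] by (metis is_unit_mult_iff)+
  ultimately show thesis
    using that[of "U * perm_mat d p" "H * perm_mat d p" "k \<circ> p"] UH p(2)
    by (simp add: o_def)
qed

section \<open>Successive minima of a reduced basis\<close>

lemma fls_abs_mult_mat_vec_le:
  fixes v :: "'a::{field,finite} fls vec"
  assumes V: "V \<in> carrier_mat d d" and v: "v \<in> carrier_vec d" and "0 \<le> r"
    and le: "\<And>j. j < d \<Longrightarrow> fls_abs (v $ j) \<le> r" and i: "i < d"
  shows "fls_abs ((map_mat fps_to_fls V *\<^sub>v v) $ i) \<le> r"
proof -
  have "(map_mat fps_to_fls V *\<^sub>v v) $ i = (\<Sum>j<d. fps_to_fls (V $$ (i, j)) * v $ j)"
    using V v i by (simp add: scalar_prod_def atLeast0LessThan)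
  also have "fls_abs \<dots> \<le> r"
  proof (rule fls_abs_sum_le)
    fix j assume "j \<in> {..<d}"
    hence "fls_abs (fps_to_fls (V $$ (i, j))) * fls_abs (v $ j) \<le> 1 * r"
      using le by (intro mult_mono fls_abs_fps_le_1 fls_abs_nonneg) auto
    thus "fls_abs (fps_to_fls (V $$ (i, j)) * v $ j) \<le> r" by (simp add: fls_abs_mult)
  qed fact
  finally show ?thesis .
qed

text \<open>
  The first \<open>i + 1\<close> columns show that the minimum is at most the stated value. Conversely, the
  coordinates of a lattice vector with respect to the columns of \<open>U\<close> are recovered by the integral
  inverse of \<open>U\<close>, so they are no larger than its norm; but the \<open>j\<close>-th coordinate is a polynomial
  multiple of \<open>x\<close> to the power \<open>k j\<close>. Hence a vector of norm below \<open>q\<close> to the power \<open>k i\<close> has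
  nonzero coordinates at the first \<open>i\<close> places only, and an independent set of such vectors has at
  most \<open>i\<close> elements.
\<close>

lemma successive_min_reduced:
  fixes U :: "'a::{field,finite} fps mat" and k :: "nat \<Rightarrow> int"
  assumes U: "U \<in> carrier_mat d d" "det U dvd 1" and k: "mono_on {..<d} k" and i: "i < d"
  shows "successive_min d
    (lattice_of d (map_mat fps_to_fls U * mat_diag d (\<lambda>i. fls_X_inv powi k i))) (Suc i)
      = real CARD('a) powi k i"
proof -
  let ?C = "map_mat fps_to_fls U" and ?q = "real CARD('a)"
  let ?D = "mat_diag d (\<lambda>i. fls_X_inv powi k i) :: 'a fls mat"
  define M where "M = ?C * ?D"
  define L where "L = lattice_of d M"
  have L_eq: "L = {M *\<^sub>v map_vec fls_of_poly p | p. p \<in> carrier_vec d}"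
    unfolding L_def by (rule lattice_of_poly)
  interpret vec_space "TYPE('a fls)" d .
  have C: "?C \<in> carrier_mat d d" using U by simp
  have D: "?D \<in> carrier_mat d d" by simp
  have M: "M \<in> carrier_mat d d" unfolding M_def using C D by (rule mult_carrier_mat)
  have M_entry: "M $$ (r, s) = fps_to_fls (U $$ (r, s)) * fls_X_inv powi k s" if "r < d" "s < d" for r s
    unfolding M_def using that U by (subst mat_diag_mult_right[of _ d]) auto
  have "det U \<noteq> 0" using U(2) by auto
  hence detC: "det ?C \<noteq> 0" by simp
  have detM: "det M \<noteq> 0"
    unfolding M_def det_mult[OF C D] using detC by (simp add: det_mat_diag)
  have dist: "inj_on (col M) {..<d}"
    using det_identical_columns[OF M] detM by (intro inj_onI) blast
  show ?thesis
    unfolding successive_min_def M_def[symmetric] L_def[symmetric]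
  proof (rule Least_equality)
    let ?S = "col M ` {..i}"
    have "?S \<subseteq> L"
    proof
      fix v assume "v \<in> ?S"
      then obtain j where j: "j \<le> i" "v = col M j" by auto
      have "v = M *\<^sub>v unit_vec d j"
        using M i j by (intro eq_vecI) auto
      also have "unit_vec d j = map_vec fls_of_poly (unit_vec d j)"
        by (intro eq_vecI) (auto simp: unit_vec_def)
      finally have "v = M *\<^sub>v map_vec fls_of_poly (unit_vec d j)" .
      thus "v \<in> L" unfolding L_eq using unit_vec_carrier by blast
    qed
    moreover have "card ?S = Suc i"
      using dist i by (subst card_image) (auto intro: inj_on_subset)
    moreover have "lin_indpt ?S"
    proof -
      have "lin_indpt (set (cols M))" using lin_dep_cols_imp_det_0[OF M] detM by blast
      moreover have "?S \<subseteq> set (cols M)" using M i by (auto simp: cols_def)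
      ultimately show ?thesis by (rule subset_li_is_li)
    qed
    moreover have "vec_max_norm v \<le> ?q powi k i" if v: "v \<in> ?S" for v
    proof -
      obtain j where j: "j \<le> i" "v = col M j" using v by auto
      have "k j \<le> k i" using k j i by (auto simp: mono_on_def)
      hence *: "?q powi k j \<le> ?q powi k i"
        using card_field_gt_1[where 'a='a] by (intro power_int_increasing) auto
      have "fls_abs (v $ r) \<le> ?q powi k i" if "r < d" for r
      proof -
        have "fls_abs (v $ r) = fls_abs (fps_to_fls (U $$ (r, j))) * ?q powi k j"
          using j i M that by (simp add: M_entry fls_abs_mult fls_abs_X_inv_powi)
        also have "\<dots> \<le> 1 * ?q powi k i"
          using * by (intro mult_mono fls_abs_fps_le_1) auto
        finally show ?thesis by simp
      qed
      thus ?thesis using j M i by (subst vec_max_norm_le_iff) auto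
    qed
    moreover have "?q powi k i > 0" by simp
    ultimately show "0 < ?q powi k i \<and> (\<exists>S\<subseteq>L. finite S \<and> card S = Suc i \<and>
        lin_indpt S \<and> (\<forall>v\<in>S. vec_max_norm v \<le> ?q powi k i))"
      by (intro conjI exI[of _ ?S] ballI finite_imageI finite_atMost)
  next
    fix r assume "0 < r \<and> (\<exists>S\<subseteq>L. finite S \<and> card S = Suc i \<and>
        lin_indpt S \<and> (\<forall>v\<in>S. vec_max_norm v \<le> r))"
    then obtain S where r: "0 < r" and S: "S \<subseteq> L" "finite S" "card S = Suc i" "lin_indpt S"
      and S_le: "\<And>v. v \<in> S \<Longrightarrow> vec_max_norm v \<le> r" by blast
    show "?q powi k i \<le> r"
    proof (rule ccontr)
      assume "\<not> ?q powi k i \<le> r"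
      hence r_less: "r < ?q powi k i" by simp
      obtain V where V: "V \<in> carrier_mat d d" "V * U = 1\<^sub>m d"
        using inverse_mat_of_unit_det[OF U] by metis
      let ?cs = "map (col ?C) [0..<i]"
      have cs: "set ?cs \<subseteq> carrier_vec d" using C by (auto intro!: carrier_vecI)
      have "v \<in> span (set ?cs)" if v: "v \<in> S" for v
      proof -
        obtain p where p: "p \<in> carrier_vec d" "v = M *\<^sub>v map_vec fls_of_poly p"
          using S(1) v unfolding L_eq by blast
        define z where "z = ?D *\<^sub>v map_vec fls_of_poly p"
        have z: "z \<in> carrier_vec d" unfolding z_def using p by (intro mult_mat_vec_carrier[OF D]) simp
        have vz: "v = ?C *\<^sub>v z"
          unfolding p(2) M_def z_def using C D p(1) by (intro assoc_mult_mat_vec) auto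
        have v_dim: "v \<in> carrier_vec d" unfolding vz using C z by simp
        have v_le: "fls_abs (v $ j) \<le> r" if "j < d" for j
          using S_le[OF v] that v_dim by (subst (asm) vec_max_norm_le_iff) auto
        have "z = map_mat fps_to_fls (V * U) *\<^sub>v z"
          using V z by (simp add: fps_fls.mat_hom_one)
        also have "\<dots> = map_mat fps_to_fls V *\<^sub>v v"
          unfolding vz fps_fls.mat_hom_mult[OF V(1) U(1)] using V(1) C z by (intro assoc_mult_mat_vec) auto
        finally have zv: "z = map_mat fps_to_fls V *\<^sub>v v" .
        have z0: "z $ j = 0" if j: "i \<le> j" "j < d" for j
        proof (rule ccontr)
          assume nz: "z $ j \<noteq> 0"
          have z_j: "z $ j = fls_X_inv powi k j * fls_of_poly (p $ j)"
          proof -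
            have "z $ j = (\<Sum>l<d. (if j = l then fls_X_inv powi k l else 0) * fls_of_poly (p $ l))"
              unfolding z_def using j p(1)
              by (simp add: mat_diag_def scalar_prod_def atLeast0LessThan)
            also have "\<dots> = (\<Sum>l<d. if l = j then fls_X_inv powi k j * fls_of_poly (p $ j) else 0)"
              by (intro sum.cong) auto
            finally show ?thesis using j by simp
          qed
          have "k i \<le> k j" using k j i by (auto simp: mono_on_def)
          hence "?q powi k i \<le> ?q powi k j"
            using card_field_gt_1[where 'a='a] by (intro power_int_increasing) auto
          also have "\<dots> \<le> ?q powi k j * fls_abs (fls_of_poly (p $ j) :: 'a fls)"
            using mult_left_mono[of 1 "fls_abs (fls_of_poly (p $ j) :: 'a fls)" "?q powi k j"]
              fls_abs_poly_ge_1[of "p $ j"] nz z_j by auto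
          also have "\<dots> = fls_abs (z $ j)" by (simp add: z_j fls_abs_mult fls_abs_X_inv_powi)
          also have "\<dots> \<le> r"
            unfolding zv using r v_le j by (intro fls_abs_mult_mat_vec_le[OF V(1) v_dim]) auto
          finally show False using r_less by simp
        qed
        \<comment> \<open>So only the first \<open>i\<close> columns of \<open>U\<close> contribute to \<open>v\<close>.\<close>
        let ?z = "vec i (\<lambda>l. z $ l)"
        have "v = mat_of_cols d ?cs *\<^sub>v ?z"
        proof (rule eq_vecI)
          fix s assume "s < dim_vec (mat_of_cols d ?cs *\<^sub>v ?z)"
          hence s: "s < d" by simp
          have "v $ s = (\<Sum>l<d. ?C $$ (s, l) * z $ l)"
            unfolding vz using C z s by (auto simp: scalar_prod_def atLeast0LessThan)
          also have "\<dots> = (\<Sum>l<i. ?C $$ (s, l) * z $ l)"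
            using i z0 by (intro sum.mono_neutral_right) auto
          also have "\<dots> = (mat_of_cols d ?cs *\<^sub>v ?z) $ s"
            using s i C by (auto simp: scalar_prod_def atLeast0LessThan mat_of_cols_index intro!: sum.cong)
          finally show "v $ s = (mat_of_cols d ?cs *\<^sub>v ?z) $ s" .
        qed (use v_dim in simp)
        moreover have "\<exists>f. mat_of_cols d ?cs *\<^sub>v ?z = lincomb f (set ?cs)"
        proof (rule exI, rule mat_of_cols_mult_as_finsum)
          show "?z \<in> carrier_vec (length ?cs)" by simp
          show "?cs ! l \<in> carrier_vec d" if "l < length ?cs" for l using cs that nth_mem by blast
        qed
        ultimately show ?thesis unfolding span_def by auto
      qed
      hence "S \<subseteq> span (set ?cs)" by blast
      (* By the replacement theorem, an independent set in a span is no larger than the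
         spanning set. *)
      from replacement[OF S(2) finite_set cs S(4) this]
      have "card S \<le> card (set ?cs)" by auto
      also have "\<dots> \<le> i" using card_length[of ?cs] by simp
      finally show False using S(3) by simp
    qed
  qed
qed

theorem theorem1p24:
  fixes d :: nat and g :: "'a::{field,finite} fls mat"
  assumes "d \<ge> 2" and "g \<in> carrier_mat d d" and "invertible_mat g"
  shows "\<exists>k :: nat \<Rightarrow> int.
           (\<forall>i<d. successive_min d (lattice_of d g) (Suc i) = real CARD('a) powi k i) \<and>
           (\<exists>u \<in> SL_over d integer_subring. \<exists>h \<in> SL_over d poly_subring.
              u * g * h = mat_diag d (\<lambda>i. fls_X_inv powi k i))"
proof -
  note g = \<open>g \<in> carrier_mat d d\<close>
  obtain B where B: "g * B = 1\<^sub>m d" "B * g = 1\<^sub>m (dim_row B)"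
    using assms(2,3) unfolding invertible_mat_def inverts_mat_def by auto
  hence "B \<in> carrier_mat d d"
    using g by (metis carrier_matD(2) carrier_matI index_mult_mat(2,3) index_one_mat(2,3))
  hence "det g * det B = 1" using det_mult[OF g] B(1) by (metis det_one)
  hence "det g \<noteq> 0" by auto
  then obtain U k H where U: "U \<in> carrier_mat d d" "det U dvd 1"
    and H: "H \<in> carrier_mat d d" "det H dvd 1" and k: "mono_on {..<d} k"
    and eq: "g * map_mat fls_of_poly H
      = map_mat fps_to_fls U * mat_diag d (\<lambda>i. fls_X_inv powi k i)" (is "_ = _ * ?D")
    using unimodular_reduction_sorted[OF g] by metis
  obtain V where V: "V \<in> carrier_mat d d" "V * U = 1\<^sub>m d" "det V dvd 1"
    using inverse_mat_of_unit_det[OF U] by metis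
  have "successive_min d (lattice_of d g) (Suc i) = real CARD('a) powi k i" if "i < d" for i
    using successive_min_reduced[OF U k that] lattice_of_mult_unimodular[OF g H] eq by simp
  moreover have "map_mat fps_to_fls V * g * map_mat fls_of_poly H = ?D"
  proof -
    have "map_mat fps_to_fls V * g * map_mat fls_of_poly H
        = map_mat fps_to_fls V * (map_mat fps_to_fls U * ?D)"
      unfolding eq[symmetric] using V g H by (intro assoc_mult_mat) auto
    also have "\<dots> = map_mat fps_to_fls (V * U) * ?D"
      unfolding fps_fls.mat_hom_mult[OF V(1) U(1)] using V U
      by (intro assoc_mult_mat[symmetric, of _ d d _ d _ d]) auto
    finally show ?thesis using V(2) by (simp add: fps_fls.mat_hom_one left_mult_one_mat[OF mat_diag_dim])
  qed
  ultimately show ?thesis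
    using SL_over_fps[OF V(1,3)] SL_over_poly[OF H] by blast
qed

end
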